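(* Let $x\in\mathcal{V}$, let $\mathcal{T}$ be an a-solvable single-path loop as described in the context such that the recurrence system $\mathsf{Rec}$ can be solved, and let $x[\vec r_1],\ldots,x[\vec r_k]$ be all elements of $\vec\ell$ whose array variable is $x$. If $\mathsf{up}(\vec r_i)-\vec r_i$ is a vector of integer constants for every $i\in[1,k]$, then \[ x^{(n)} := \lambda\vec c.\ \mathbf{if}\ 1\le e_{x[\vec r_1]}\le n\wedge\mathsf{last\_write}_{x[\vec r_1]}(e_{x[\vec r_1]},n,\vec c)\ \mathbf{then}\ \mathsf{rhs}(x[\vec r_1])^{(e_{x[\vec r_1]}-1)}\ \mathbf{else}\ \cdots\ \mathbf{else\ if}\ 1\le e_{x[\vec r_k]}\le n\wedge\mathsf{last\_write}_{x[\vec r_k]}(e_{x[\vec r_k]},n,\vec c)\ \mathbf{then}\ \mathsf{rhs}(x[\vec r_k])^{(e_{x[\vec r_k]}-1)}\ \mathbf{else}\ x[\vec c] \] is a closed form for $x$, i.e., $x^{(n)}=\mathsf{up}^n(x)$ holds for all $n\in\mathbb{N}$.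
   Context: Variables and arrays: $\mathcal{V}$ is a countably infinite set of variables, each with an arity; $x$ denotes a function $\mathbb{Z}^{\mathsf{arity}(x)}\to\mathbb{Z}$ (arity $0$ = scalar; $i[\,]$ written $i$). Rvalues: $r::=c\mid r\circ r\mid x[r_1,\ldots,r_k]$ ($c\in\mathbb{Z}$, $\circ$ arithmetic operator among $+,-,\cdot$, integer division $\div$). An lvalue is an rvalue of the form $x[\vec r]$. $\mathit{Lval}(r)$ = top-level lvalues of $r$: $\{r\}$ if $r$ is an lvalue, $\mathit{Lval}(r_1)\cup\mathit{Lval}(r_2)$ if $r=r_1\circ r_2$, $\emptyset$ for integers; unions for vectors. Expressions may contain if-then-else and $\lambda$-array expressions $\lambda\vec c.\,e$ (denoting functions); an equation holds/is valid if true in every state, arrays being compared as functions. Loop $\mathcal{T}$: $\mathbf{while}\ \phi\ \mathbf{do}\ (\ell_1,\ldots,\ell_m)\leftarrow(r_1,\ldots,r_m)$, $\phi$ a conjunction of (in)equations over rvalues, $\ell_j=x_j[\vec r_j]$ lvalues with $x_i\ne x_j$ or $\vec r_i\ne\vec r_j$ for $i\ne j$, simultaneous update; $\vec\ell=(\ell_1,\ldots,\ell_m)$, $\mathsf{rhs}(x_j[\vec r_j]):=r_j$. Update: $\mathsf{up}_x(\text{empty})=x$; $\mathsf{up}_x(x[\vec r],\vec\ell')=\lambda\vec i.\ \mathbf{if}\ \vec i=\vec r\ \mathbf{then}\ \mathsf{rhs}(x[\vec r])\ \mathbf{else}\ \mathsf{up}_x(\vec\ell')[\vec i]$ ($\vec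 i$ fresh); $\mathsf{up}_x(y[\vec r],\vec\ell')=\mathsf{up}_x(\vec\ell')$ for $y\ne x$. $\mathsf{up}=[x/\mathsf{up}_x(\vec\ell)\mid x\in\mathcal{V}]$ (componentwise on vectors); $\mathsf{up}^n$ its $n$-fold iteration. Monotonicity and a-solvability: vectors compared lexicographically (empty vectors equal); following the paper's convention that monotonic loops are increasing, $\mathcal{T}$ is monotonic if for every $x$, $\bigwedge_{x[\vec r]\in\vec\ell}\vec r\le\mathsf{up}(\vec r)$ is valid. $\mathcal{L}$ is the smallest set with $\mathit{Lval}(r_j)\subseteq\mathcal{L}$ for all $j$ and $x[\vec r]\in\mathcal{L}\Rightarrow\mathit{Lval}(\vec r)\subseteq\mathcal{L}$. For $x[\vec r]\in\mathcal{L}$: trivial if no $y$ with $y[\vec r']\in\vec\ell$ occurs in $x[\vec r]$; inductive if $x[\mathsf{up}(\vec r)]\in\vec\ell$; displacing if $\vec r'<\mathsf{up}(\vec r)$ is valid whenever $x[\vec r']\in\vec\ell$. $\mathcal{T}$ is a-solvable if monotonic, each element of $\mathcal{L}$ is trivial, inductive or displacing, and for each $j$ all lvalues of $\mathit{Lval}(r_j)$ are trivial or inductive, or all are displacing. Recurrences: $\sigma_{\mathsf{rec}}$ replaces each top-level lvalue $\ell$ by a fresh symbol $\mathsf{rec}_\ell$; $\mathsf{Rec}$ consists of the equations $\mathsf{rec}'_{x[\vec r]}=\mathsf{rhs}(x[\mathsf{up}(\vec r)])\sigma_{\mathsf{rec}}$ for each inductive $x[\vec r]\in\mathcal{L}$;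 a solution is a substitution $\theta$ into arithmetic expressions over the symbols and a fresh variable $n$ with $\theta(\mathsf{rec})[n/n+1]=\theta(e)$ and $\theta(\mathsf{rec})[n/0]=\mathsf{rec}$ valid for each equation $\mathsf{rec}'=e$. Closed forms: an expression $y^{(n)}$ over $\mathcal{V}\cup\{n\}$ is a closed form for a variable or lvalue $y$ if $y^{(n)}=\mathsf{up}^n(y)$ holds for all $n\in\mathbb{N}$. A closed form $\ell^{(n)}$ is fixed for every lvalue occurring at top level in the index vectors or right-hand sides of the loop; for such an rvalue or vector $e$, $e^{(n)}:=e[\ell/\ell^{(n)}\mid\ell\in\mathit{Lval}(e)]$ and $e^{(k)}:=e^{(n)}[n/k]$. Predicates: for $x[\vec r]\in\vec\ell$: $\mathsf{written}_{\vec r}(m,\vec c)\iff\vec r^{(m-1)}=\vec c$; $\mathsf{notwritten}_x(m,n,\vec c)\iff\bigwedge_{x[\vec r]\in\vec\ell}\forall m'\in[m,n].\ \neg\mathsf{written}_{\vec r}(m',\vec c)$; $\mathsf{last\_write}_{x[\vec r]}(m,n,\vec c)\iff\mathsf{written}_{\vec r}(m,\vec c)\wedge\mathsf{notwritten}_x(m+1,n,\vec c)$. Instantiation $e_{x[\vec r]}$: for $x[\vec r]\in\vec\ell$ with $\vec d:=\mathsf{up}(\vec r)-\vec r$ a constant vector, if some $d_i\neq0$ then (for a fixed such $i$) $e_{x[\vec r]}:=(c_i-r_i)\div d_i+1$, and if $\vec d$ is the zero vector then $e_{x[\vec r]}:=n$. (This is the expression such that $\forall m\in[1,n].\ \mathsf{last\_write}_{x[\vec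 r]}(m,n,\vec c)\Rightarrow\mathsf{up}^n(x)[\vec c]=\mathsf{rhs}(x[\vec r])^{(m-1)}$ is equivalent to its instance at $m=e_{x[\vec r]}$ guarded by $1\le e_{x[\vec r]}\le n$.) *)

theory Defs
  imports Main "HOL-Library.Countable_Set"
begin

text \<open>Integer division is \<^const>\<open>divide\<close> on \<^typ>\<open>int\<close>: it rounds down, and division by zero yields zero.\<close>

datatype binop = Plus | Minus | Times | Quot

fun binop_sem :: "binop \<Rightarrow> int \<Rightarrow> int \<Rightarrow> int" where
  "binop_sem Plus a b = a + b"
| "binop_sem Minus a b = a - b"
| "binop_sem Times a b = a * b"
| "binop_sem Quot a b = a div b"

datatype rel = EQ | NEQ | LEQ | LESS

fun rel_sem :: "rel \<Rightarrow> int \<Rightarrow> int \<Rightarrow> bool" where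
  "rel_sem EQ a b = (a = b)"
| "rel_sem NEQ a b = (a \<noteq> b)"
| "rel_sem LEQ a b = (a \<le> b)"
| "rel_sem LESS a b = (a < b)"

datatype 'v rval = Num int | Op binop "'v rval" "'v rval" | Lv 'v "'v rval list"

type_synonym 'v lval = "'v \<times> 'v rval list"

fun Lval :: "'v rval \<Rightarrow> 'v lval set" where
  "Lval (Num c) = {}"
| "Lval (Op b r1 r2) = Lval r1 \<union> Lval r2"
| "Lval (Lv x rs) = {(x, rs)}"

abbreviation Lval_vec :: "'v rval list \<Rightarrow> 'v lval set" where
  "Lval_vec rs \<equiv> (\<Union>r\<in>set rs. Lval r)"

fun rval_vars :: "'v rval \<Rightarrow> 'v set" where
  "rval_vars (Num c) = {}"
| "rval_vars (Op b r1 r2) = rval_vars r1 \<union> rval_vars r2"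
| "rval_vars (Lv x rs) = insert x (\<Union>r\<in>set rs. rval_vars r)"

fun wf_rval :: "('v \<Rightarrow> nat) \<Rightarrow> 'v rval \<Rightarrow> bool" where
  "wf_rval ar (Num c) \<longleftrightarrow> True"
| "wf_rval ar (Op b r1 r2) \<longleftrightarrow> wf_rval ar r1 \<and> wf_rval ar r2"
| "wf_rval ar (Lv x rs) \<longleftrightarrow> length rs = ar x \<and> (\<forall>r\<in>set rs. wf_rval ar r)"

text \<open>The guard is the conjunction of its list of comparisons.\<close>

datatype 'v loop =
  Loop (guard: "(rel \<times> 'v rval \<times> 'v rval) list") (assigns: "('v lval \<times> 'v rval) list")

abbreviation lhss :: "'v loop \<Rightarrow> 'v lval list" where
  "lhss T \<equiv> map fst (assigns T)"

text \<open>Left-hand sides are required to be distinct as terms; two of them may still denote the same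
  cell in some states, in which case the first one takes precedence in \<open>up_arr\<close> below.\<close>

definition wf_loop :: "('v \<Rightarrow> nat) \<Rightarrow> 'v loop \<Rightarrow> bool" where
  "wf_loop ar T \<longleftrightarrow>
     (\<forall>(b, r1, r2) \<in> set (guard T). wf_rval ar r1 \<and> wf_rval ar r2) \<and>
     (\<forall>((x, rs), r) \<in> set (assigns T). wf_rval ar (Lv x rs) \<and> wf_rval ar r) \<and>
     distinct (lhss T)"

text \<open>
  \<open>Nvar\<close> is the distinguished scalar \<open>n\<close>. Bound scalars are de Bruijn indices:
  \<open>Lam k e\<close> binds the \<open>k\<close> indices of a \<open>k\<close>-ary array, the \<open>i\<close>-th one being \<open>Bnd i\<close> in \<open>e\<close>, and
  \<open>AllIn a b \<phi>\<close> states that \<open>\<phi>\<close> holds for all values of \<open>Bnd 0\<close> in the interval \<open>[a, b]\<close>,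
  where \<open>a\<close> and \<open>b\<close> are outside the scope of the binder.
  Program variables \<open>Var x\<close> are never bound.
\<close>

datatype 'v expr =
    Const int
  | Nvar
  | Bnd nat
  | Bin binop "'v expr" "'v expr"
  | Pow "'v expr" "'v expr"
  | Read "'v arr" "'v expr list"
  | Ite "'v cond" "'v expr" "'v expr"
and 'v arr =
    Var 'v
  | Lam nat "'v expr"
and 'v cond =
    Cmp rel "'v expr" "'v expr"
  | Neg "'v cond"
  | Conj "'v cond list"
  | AllIn "'v expr" "'v expr" "'v cond"

text \<open>Only the values of \<open>s x\<close> at vectors of length \<open>ar x\<close> are meaningful. The third argument
  is the value of \<open>n\<close>, the fourth one lists the values of the bound scalars.\<close>

type_synonym 'v state = "'v \<Rightarrow> int list \<Rightarrow> int"

fun eval :: "'v expr \<Rightarrow> 'v state \<Rightarrow> int \<Rightarrow> int list \<Rightarrow> int"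
  and eval_arr :: "'v arr \<Rightarrow> 'v state \<Rightarrow> int \<Rightarrow> int list \<Rightarrow> int list \<Rightarrow> int"
  and eval_cond :: "'v cond \<Rightarrow> 'v state \<Rightarrow> int \<Rightarrow> int list \<Rightarrow> bool" where
  "eval (Const c) s n env = c"
| "eval Nvar s n env = n"
| "eval (Bnd i) s n env = env ! i"
| "eval (Bin b e1 e2) s n env = binop_sem b (eval e1 s n env) (eval e2 s n env)"
| "eval (Pow e1 e2) s n env = eval e1 s n env ^ nat (eval e2 s n env)"
| "eval (Read a es) s n env = eval_arr a s n env (map (\<lambda>e. eval e s n env) es)"
| "eval (Ite p e1 e2) s n env = (if eval_cond p s n env then eval e1 s n env else eval e2 s n env)"
| "eval_arr (Var x) s n env cs = s x cs"
| "eval_arr (Lam k e) s n env cs = eval e s n (cs @ env)"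
| "eval_cond (Cmp b e1 e2) s n env = rel_sem b (eval e1 s n env) (eval e2 s n env)"
| "eval_cond (Neg p) s n env = (\<not> eval_cond p s n env)"
| "eval_cond (Conj ps) s n env = (\<forall>p\<in>set ps. eval_cond p s n env)"
| "eval_cond (AllIn e1 e2 p) s n env =
     (\<forall>m\<in>{eval e1 s n env..eval e2 s n env}. eval_cond p s n (m # env))"

text \<open>Arities are respected and all bound scalars are below \<open>d\<close>. Expressions over the program
  variables and \<open>n\<close> are those with \<open>d = 0\<close>. The argument \<open>k\<close> of \<open>wf_arr\<close> is the arity of
  the array.\<close>

fun wf_expr :: "('v \<Rightarrow> nat) \<Rightarrow> nat \<Rightarrow> 'v expr \<Rightarrow> bool"
  and wf_arr :: "('v \<Rightarrow> nat) \<Rightarrow> nat \<Rightarrow> nat \<Rightarrow> 'v arr \<Rightarrow> bool"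
  and wf_cond :: "('v \<Rightarrow> nat) \<Rightarrow> nat \<Rightarrow> 'v cond \<Rightarrow> bool" where
  "wf_expr ar d (Const c) \<longleftrightarrow> True"
| "wf_expr ar d Nvar \<longleftrightarrow> True"
| "wf_expr ar d (Bnd i) \<longleftrightarrow> i < d"
| "wf_expr ar d (Bin b e1 e2) \<longleftrightarrow> wf_expr ar d e1 \<and> wf_expr ar d e2"
| "wf_expr ar d (Pow e1 e2) \<longleftrightarrow> wf_expr ar d e1 \<and> wf_expr ar d e2"
| "wf_expr ar d (Read a es) \<longleftrightarrow> wf_arr ar d (length es) a \<and> (\<forall>e\<in>set es. wf_expr ar d e)"
| "wf_expr ar d (Ite p e1 e2) \<longleftrightarrow> wf_cond ar d p \<and> wf_expr ar d e1 \<and> wf_expr ar d e2"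
| "wf_arr ar d k (Var x) \<longleftrightarrow> ar x = k"
| "wf_arr ar d k (Lam k' e) \<longleftrightarrow> k' = k \<and> wf_expr ar (k + d) e"
| "wf_cond ar d (Cmp b e1 e2) \<longleftrightarrow> wf_expr ar d e1 \<and> wf_expr ar d e2"
| "wf_cond ar d (Neg p) \<longleftrightarrow> wf_cond ar d p"
| "wf_cond ar d (Conj ps) \<longleftrightarrow> (\<forall>p\<in>set ps. wf_cond ar d p)"
| "wf_cond ar d (AllIn e1 e2 p) \<longleftrightarrow> wf_expr ar d e1 \<and> wf_expr ar d e2 \<and> wf_cond ar (Suc d) p"

fun expr_of :: "'v rval \<Rightarrow> 'v expr" where
  "expr_of (Num c) = Const c"
| "expr_of (Op b r1 r2) = Bin b (expr_of r1) (expr_of r2)"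
| "expr_of (Lv x rs) = Read (Var x) (map expr_of rs)"

text \<open>Substitution of arrays for program variables. The substituted arrays are inserted under
  binders unchanged, so they must not have free bound scalars; it is only used for \<open>up_arr\<close>,
  whose values are closed.\<close>

fun vsubst :: "('v \<Rightarrow> 'v arr) \<Rightarrow> 'v expr \<Rightarrow> 'v expr"
  and vsubst_arr :: "('v \<Rightarrow> 'v arr) \<Rightarrow> 'v arr \<Rightarrow> 'v arr"
  and vsubst_cond :: "('v \<Rightarrow> 'v arr) \<Rightarrow> 'v cond \<Rightarrow> 'v cond" where
  "vsubst \<sigma> (Const c) = Const c"
| "vsubst \<sigma> Nvar = Nvar"
| "vsubst \<sigma> (Bnd i) = Bnd i"
| "vsubst \<sigma> (Bin b e1 e2) = Bin b (vsubst \<sigma> e1) (vsubst \<sigma> e2)"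
| "vsubst \<sigma> (Pow e1 e2) = Pow (vsubst \<sigma> e1) (vsubst \<sigma> e2)"
| "vsubst \<sigma> (Read a es) = Read (vsubst_arr \<sigma> a) (map (vsubst \<sigma>) es)"
| "vsubst \<sigma> (Ite p e1 e2) = Ite (vsubst_cond \<sigma> p) (vsubst \<sigma> e1) (vsubst \<sigma> e2)"
| "vsubst_arr \<sigma> (Var x) = \<sigma> x"
| "vsubst_arr \<sigma> (Lam k e) = Lam k (vsubst \<sigma> e)"
| "vsubst_cond \<sigma> (Cmp b e1 e2) = Cmp b (vsubst \<sigma> e1) (vsubst \<sigma> e2)"
| "vsubst_cond \<sigma> (Neg p) = Neg (vsubst_cond \<sigma> p)"
| "vsubst_cond \<sigma> (Conj ps) = Conj (map (vsubst_cond \<sigma>) ps)"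
| "vsubst_cond \<sigma> (AllIn e1 e2 p) = AllIn (vsubst \<sigma> e1) (vsubst \<sigma> e2) (vsubst_cond \<sigma> p)"

text \<open>\<open>lift k d e\<close> renames \<open>Bnd i\<close> with \<open>i \<ge> d\<close> to \<open>Bnd (i + k)\<close>, which makes room for \<open>k\<close>
  further binders around \<open>e\<close> when \<open>d = 0\<close>.\<close>

fun lift :: "nat \<Rightarrow> nat \<Rightarrow> 'v expr \<Rightarrow> 'v expr"
  and lift_arr :: "nat \<Rightarrow> nat \<Rightarrow> 'v arr \<Rightarrow> 'v arr"
  and lift_cond :: "nat \<Rightarrow> nat \<Rightarrow> 'v cond \<Rightarrow> 'v cond" where
  "lift k d (Const c) = Const c"
| "lift k d Nvar = Nvar"
| "lift k d (Bnd i) = Bnd (if i < d then i else i + k)"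
| "lift k d (Bin b e1 e2) = Bin b (lift k d e1) (lift k d e2)"
| "lift k d (Pow e1 e2) = Pow (lift k d e1) (lift k d e2)"
| "lift k d (Read a es) = Read (lift_arr k d a) (map (lift k d) es)"
| "lift k d (Ite p e1 e2) = Ite (lift_cond k d p) (lift k d e1) (lift k d e2)"
| "lift_arr k d (Var x) = Var x"
| "lift_arr k d (Lam j e) = Lam j (lift k (j + d) e)"
| "lift_cond k d (Cmp b e1 e2) = Cmp b (lift k d e1) (lift k d e2)"
| "lift_cond k d (Neg p) = Neg (lift_cond k d p)"
| "lift_cond k d (Conj ps) = Conj (map (lift_cond k d) ps)"
| "lift_cond k d (AllIn e1 e2 p) = AllIn (lift k d e1) (lift k d e2) (lift_cond k (Suc d) p)"

text \<open>Capture-avoiding substitution of \<open>t\<close> for \<open>n\<close>.\<close>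

fun nsubst :: "'v expr \<Rightarrow> 'v expr \<Rightarrow> 'v expr"
  and nsubst_arr :: "'v expr \<Rightarrow> 'v arr \<Rightarrow> 'v arr"
  and nsubst_cond :: "'v expr \<Rightarrow> 'v cond \<Rightarrow> 'v cond" where
  "nsubst t (Const c) = Const c"
| "nsubst t Nvar = t"
| "nsubst t (Bnd i) = Bnd i"
| "nsubst t (Bin b e1 e2) = Bin b (nsubst t e1) (nsubst t e2)"
| "nsubst t (Pow e1 e2) = Pow (nsubst t e1) (nsubst t e2)"
| "nsubst t (Read a es) = Read (nsubst_arr t a) (map (nsubst t) es)"
| "nsubst t (Ite p e1 e2) = Ite (nsubst_cond t p) (nsubst t e1) (nsubst t e2)"
| "nsubst_arr t (Var x) = Var x"
| "nsubst_arr t (Lam j e) = Lam j (nsubst (lift j 0 t) e)"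
| "nsubst_cond t (Cmp b e1 e2) = Cmp b (nsubst t e1) (nsubst t e2)"
| "nsubst_cond t (Neg p) = Neg (nsubst_cond t p)"
| "nsubst_cond t (Conj ps) = Conj (map (nsubst_cond t) ps)"
| "nsubst_cond t (AllIn e1 e2 p) =
     AllIn (nsubst t e1) (nsubst t e2) (nsubst_cond (lift 1 0 t) p)"

definition valid :: "(int list \<Rightarrow> int list \<Rightarrow> bool) \<Rightarrow> 'v expr list \<Rightarrow> 'v expr list \<Rightarrow> bool" where
  "valid R es es' \<longleftrightarrow>
     (\<forall>s. \<forall>n::nat. R (map (\<lambda>e. eval e s (int n) []) es) (map (\<lambda>e. eval e s (int n) []) es'))"

definition vec_eq :: "'v expr list \<Rightarrow> 'v expr list \<Rightarrow> 'v cond" where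
  "vec_eq es es' = Conj (map2 (Cmp EQ) es es')"

fun up_arr :: "('v \<Rightarrow> nat) \<Rightarrow> ('v lval \<times> 'v rval) list \<Rightarrow> 'v \<Rightarrow> 'v arr" where
  "up_arr ar [] x = Var x"
| "up_arr ar (((y, rs), r) # as) x =
     (if y = x
      then Lam (ar x)
             (Ite (vec_eq (map Bnd [0..<ar x]) (map expr_of rs))
                (expr_of r)
                (Read (up_arr ar as x) (map Bnd [0..<ar x])))
      else up_arr ar as x)"

abbreviation up :: "('v \<Rightarrow> nat) \<Rightarrow> 'v loop \<Rightarrow> 'v expr \<Rightarrow> 'v expr" where
  "up ar T \<equiv> vsubst (up_arr ar (assigns T))"

abbreviation up_on_arr :: "('v \<Rightarrow> nat) \<Rightarrow> 'v loop \<Rightarrow> 'v arr \<Rightarrow> 'v arr" where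
  "up_on_arr ar T \<equiv> vsubst_arr (up_arr ar (assigns T))"

abbreviation up_vec :: "('v \<Rightarrow> nat) \<Rightarrow> 'v loop \<Rightarrow> 'v rval list \<Rightarrow> 'v expr list" where
  "up_vec ar T rs \<equiv> map (\<lambda>r. up ar T (expr_of r)) rs"

definition closed_form_lval :: "('v \<Rightarrow> nat) \<Rightarrow> 'v loop \<Rightarrow> 'v lval \<Rightarrow> 'v expr \<Rightarrow> bool" where
  "closed_form_lval ar T l e \<longleftrightarrow>
     wf_expr ar 0 e \<and>
     (\<forall>n::nat. \<forall>s. eval e s (int n) [] =
        eval ((up ar T ^^ n) (expr_of (Lv (fst l) (snd l)))) s (int n) [])"

definition closed_form_var :: "('v \<Rightarrow> nat) \<Rightarrow> 'v loop \<Rightarrow> 'v \<Rightarrow> 'v arr \<Rightarrow> bool" where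
  "closed_form_var ar T x a \<longleftrightarrow>
     wf_arr ar 0 (ar x) a \<and>
     (\<forall>n::nat. \<forall>s cs. length cs = ar x \<longrightarrow>
        eval_arr a s (int n) [] cs = eval_arr ((up_on_arr ar T ^^ n) (Var x)) s (int n) [] cs)"

definition monotonic :: "('v \<Rightarrow> nat) \<Rightarrow> 'v loop \<Rightarrow> bool" where
  "monotonic ar T \<longleftrightarrow>
     (\<forall>(x, rs) \<in> set (lhss T). valid ord_class.lexordp_eq (map expr_of rs) (up_vec ar T rs))"

inductive_set relevant :: "'v loop \<Rightarrow> 'v lval set" for T where
  rhs: "(l', r) \<in> set (assigns T) \<Longrightarrow> l \<in> Lval r \<Longrightarrow> l \<in> relevant T"
| index: "(x, rs) \<in> relevant T \<Longrightarrow> l \<in> Lval_vec rs \<Longrightarrow> l \<in> relevant T"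

definition trivial :: "'v loop \<Rightarrow> 'v lval \<Rightarrow> bool" where
  "trivial T l \<longleftrightarrow> (\<forall>(y, rs') \<in> set (lhss T). y \<notin> rval_vars (Lv (fst l) (snd l)))"

text \<open>\<open>updates_to ar T (x, rs) (y, rs')\<close> says that \<open>x[up(rs)]\<close> is the lvalue \<open>y[rs']\<close>, where index
  vectors are identified if they are equal in every state.\<close>

definition updates_to :: "('v \<Rightarrow> nat) \<Rightarrow> 'v loop \<Rightarrow> 'v lval \<Rightarrow> 'v lval \<Rightarrow> bool" where
  "updates_to ar T l l' \<longleftrightarrow>
     fst l' = fst l \<and> valid (=) (map expr_of (snd l')) (up_vec ar T (snd l))"

definition inductive_lval :: "('v \<Rightarrow> nat) \<Rightarrow> 'v loop \<Rightarrow> 'v lval \<Rightarrow> bool" where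
  "inductive_lval ar T l \<longleftrightarrow> (\<exists>l' \<in> set (lhss T). updates_to ar T l l')"

definition displacing :: "('v \<Rightarrow> nat) \<Rightarrow> 'v loop \<Rightarrow> 'v lval \<Rightarrow> bool" where
  "displacing ar T l \<longleftrightarrow>
     (\<forall>(y, rs') \<in> set (lhss T). y = fst l \<longrightarrow>
        valid ord_class.lexordp (map expr_of rs') (up_vec ar T (snd l)))"

definition a_solvable :: "('v \<Rightarrow> nat) \<Rightarrow> 'v loop \<Rightarrow> bool" where
  "a_solvable ar T \<longleftrightarrow>
     monotonic ar T \<and>
     (\<forall>l \<in> relevant T. trivial T l \<or> inductive_lval ar T l \<or> displacing ar T l) \<and>
     (\<forall>(l', r) \<in> set (assigns T).
        (\<forall>l \<in> Lval r. trivial T l \<or> inductive_lval ar T l) \<or> (\<forall>l \<in> Lval r. displacing ar T l))"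

text \<open>Arithmetic expressions over the symbols \<open>Rec l\<close> and \<open>n\<close>. Besides the operators of
  rvalues there is exponentiation, as solutions of linear recurrences are usually exponential.\<close>

datatype 'a arith =
    ANum int
  | AN
  | Rec 'a
  | AOp binop "'a arith" "'a arith"
  | APow "'a arith" "'a arith"

primrec aeval :: "'a arith \<Rightarrow> ('a \<Rightarrow> int) \<Rightarrow> int \<Rightarrow> int" where
  "aeval (ANum c) \<rho> n = c"
| "aeval AN \<rho> n = n"
| "aeval (Rec l) \<rho> n = \<rho> l"
| "aeval (AOp b t1 t2) \<rho> n = binop_sem b (aeval t1 \<rho> n) (aeval t2 \<rho> n)"
| "aeval (APow t1 t2) \<rho> n = aeval t1 \<rho> n ^ nat (aeval t2 \<rho> n)"

primrec asubst :: "('a \<Rightarrow> 'a arith) \<Rightarrow> 'a arith \<Rightarrow> 'a arith \<Rightarrow> 'a arith" where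
  "asubst \<theta> u (ANum c) = ANum c"
| "asubst \<theta> u AN = u"
| "asubst \<theta> u (Rec l) = \<theta> l"
| "asubst \<theta> u (AOp b t1 t2) = AOp b (asubst \<theta> u t1) (asubst \<theta> u t2)"
| "asubst \<theta> u (APow t1 t2) = APow (asubst \<theta> u t1) (asubst \<theta> u t2)"

definition avalid_eq :: "'a arith \<Rightarrow> 'a arith \<Rightarrow> bool" where
  "avalid_eq t t' \<longleftrightarrow> (\<forall>\<rho>. \<forall>n::nat. aeval t \<rho> (int n) = aeval t' \<rho> (int n))"

fun rec_subst :: "'v rval \<Rightarrow> 'v lval arith" where
  "rec_subst (Num c) = ANum c"
| "rec_subst (Op b r1 r2) = AOp b (rec_subst r1) (rec_subst r2)"
| "rec_subst (Lv x rs) = Rec (x, rs)"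

text \<open>The right-hand side of \<open>x[up(rs)]\<close>, for inductive \<open>l = (x, rs)\<close>. If several left-hand sides match,
  the first one determines the value that is written.\<close>

definition rhs_up :: "('v \<Rightarrow> nat) \<Rightarrow> 'v loop \<Rightarrow> 'v lval \<Rightarrow> 'v rval" where
  "rhs_up ar T l = snd (the (find (\<lambda>a. updates_to ar T l (fst a)) (assigns T)))"

text \<open>A pair \<open>(l, t)\<close> stands for the equation with left-hand side the successor value of \<open>Rec l\<close> and
  right-hand side \<open>t\<close>.\<close>

definition recurrences :: "('v \<Rightarrow> nat) \<Rightarrow> 'v loop \<Rightarrow> ('v lval \<times> 'v lval arith) set" where
  "recurrences ar T =
     {(l, rec_subst (rhs_up ar T l)) | l. l \<in> relevant T \<and> inductive_lval ar T l}"

definition rec_solution :: "('a \<times> 'a arith) set \<Rightarrow> ('a \<Rightarrow> 'a arith) \<Rightarrow> bool" where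
  "rec_solution E \<theta> \<longleftrightarrow>
     (\<forall>(l, t) \<in> E.
        avalid_eq (asubst Rec (AOp Plus AN (ANum 1)) (\<theta> l)) (asubst \<theta> AN t) \<and>
        avalid_eq (asubst Rec (ANum 0) (\<theta> l)) (Rec l))"

definition cf_lvals :: "'v loop \<Rightarrow> 'v lval set" where
  "cf_lvals T = (\<Union>((x, rs), r) \<in> set (assigns T). Lval_vec rs \<union> Lval r)"

fun cf_rval :: "('v lval \<Rightarrow> 'v expr) \<Rightarrow> 'v rval \<Rightarrow> 'v expr" where
  "cf_rval cf (Num c) = Const c"
| "cf_rval cf (Op b r1 r2) = Bin b (cf_rval cf r1) (cf_rval cf r2)"
| "cf_rval cf (Lv x rs) = cf (x, rs)"

definition cf_at :: "('v lval \<Rightarrow> 'v expr) \<Rightarrow> 'v rval \<Rightarrow> 'v expr \<Rightarrow> 'v expr" where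
  "cf_at cf r k = nsubst k (cf_rval cf r)"

definition written :: "('v lval \<Rightarrow> 'v expr) \<Rightarrow> 'v rval list \<Rightarrow> 'v expr \<Rightarrow> 'v expr list \<Rightarrow> 'v cond" where
  "written cf rs m cs = vec_eq (map (\<lambda>r. cf_at cf r (Bin Minus m (Const 1))) rs) cs"

text \<open>The order of the assignments in the loop is kept: it is the order of the cases in the closed form.\<close>

definition assigns_of :: "'v loop \<Rightarrow> 'v \<Rightarrow> ('v rval list \<times> 'v rval) list" where
  "assigns_of T x = map (\<lambda>((y, rs), r). (rs, r)) (filter (\<lambda>((y, rs), r). y = x) (assigns T))"

definition notwritten ::
  "('v lval \<Rightarrow> 'v expr) \<Rightarrow> 'v loop \<Rightarrow> 'v \<Rightarrow> 'v expr \<Rightarrow> 'v expr \<Rightarrow> 'v expr list \<Rightarrow> 'v cond" where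
  "notwritten cf T x m n cs =
     Conj (map (\<lambda>(rs, r). AllIn m n (Neg (written cf rs (Bnd 0) (map (lift 1 0) cs))))
       (assigns_of T x))"

definition last_write ::
  "('v lval \<Rightarrow> 'v expr) \<Rightarrow> 'v loop \<Rightarrow> 'v \<Rightarrow> 'v rval list \<Rightarrow> 'v expr \<Rightarrow> 'v expr \<Rightarrow> 'v expr list \<Rightarrow> 'v cond"
where
  "last_write cf T x rs m n cs =
     Conj [written cf rs m cs, notwritten cf T x (Bin Plus m (Const 1)) n cs]"

definition displacement :: "('v \<Rightarrow> nat) \<Rightarrow> 'v loop \<Rightarrow> 'v rval list \<Rightarrow> int list \<Rightarrow> bool" where
  "displacement ar T rs d \<longleftrightarrow>
     valid (=) (map2 (Bin Minus) (up_vec ar T rs) (map expr_of rs)) (map Const d)"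

text \<open>The iteration of the last write, where \<open>i\<close> is the chosen component in which \<open>d\<close> is not zero
  (it is irrelevant if \<open>d\<close> is zero).\<close>

definition inst :: "'v rval list \<Rightarrow> int list \<Rightarrow> nat \<Rightarrow> 'v expr list \<Rightarrow> 'v expr" where
  "inst rs d i cs =
     (if \<exists>j < length d. d ! j \<noteq> 0
      then Bin Plus (Bin Quot (Bin Minus (cs ! i) (expr_of (rs ! i))) (Const (d ! i))) (Const 1)
      else Nvar)"

definition array_closed_form ::
  "('v \<Rightarrow> nat) \<Rightarrow> 'v loop \<Rightarrow> ('v lval \<Rightarrow> 'v expr) \<Rightarrow> ('v rval list \<Rightarrow> int list) \<Rightarrow>
    ('v rval list \<Rightarrow> nat) \<Rightarrow> 'v \<Rightarrow> 'v arr" where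
  "array_closed_form ar T cf d pick x =
     (let cs = map Bnd [0..<ar x] in
      Lam (ar x)
        (foldr
          (\<lambda>(rs, r) e'.
             let e = inst rs (d rs) (pick rs) cs in
             Ite (Conj [Cmp LEQ (Const 1) e, Cmp LEQ e Nvar, last_write cf T x rs e Nvar cs])
               (cf_at cf r (Bin Minus e (Const 1)))
               e')
          (assigns_of T x)
          (Read (Var x) cs)))"

end

theory Submission
  imports Defs
begin

text \<open>Substituting \<open>up\<close> amounts to evaluating in the state after one iteration, so \<open>up\<close> applied \<open>n\<close>
  times to \<open>x\<close> is the array \<open>x\<close> after \<open>n\<close> iterations. Its value at \<open>cs\<close> is determined by the last
  iteration \<open>k + 1 \<le> n\<close> that writes to \<open>cs\<close> and, in this iteration, by the first matching assignment.
  Since the index vector of an assignment moves by the constant vector \<open>d\<close> in each iteration, an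
  index vector that meets \<open>cs\<close> in iteration \<open>k + 1\<close> for the last time satisfies
  \<open>cs = rs + k * d\<close>, so \<open>k + 1\<close> is recovered by \<open>inst\<close>: as \<open>(cs\<^sub>i - rs\<^sub>i) div d\<^sub>i + 1\<close> if some \<open>d\<^sub>i\<close> is not
  zero, and as \<open>n\<close> otherwise. Hence exactly the cases of the assignments matching in iteration
  \<open>k + 1\<close> are enabled, and the first of them is the one that took effect.\<close>

section \<open>Well-formedness and evaluation\<close>

lemma wf_expr_mono:
  "wf_expr ar D e \<Longrightarrow> D \<le> D' \<Longrightarrow> wf_expr ar D' e"
  "wf_arr ar D k a \<Longrightarrow> D \<le> D' \<Longrightarrow> wf_arr ar D' k a"
  "wf_cond ar D p \<Longrightarrow> D \<le> D' \<Longrightarrow> wf_cond ar D' p"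
proof (induct e and a and p arbitrary: D D' and D D' k and D D' rule: expr.induct arr.induct cond.induct)
  case (Lam j e)
  then show ?case using Lam.hyps[of "k + D" "k + D'"] by auto
next
  case (AllIn e1 e2 p)
  then show ?case using AllIn.hyps(3)[of "Suc D" "Suc D'"] by auto
qed auto

text \<open>Closed forms of lvalues are specified in the empty environment but are inserted under
  \<open>Lam\<close> and \<open>AllIn\<close>; the instance \<open>env = []\<close> shows that they
  keep their values there.\<close>

lemma eval_append_env:
  "wf_expr ar (length env) e \<Longrightarrow> eval e s n (env @ env') = eval e s n env"
  "wf_arr ar (length env) (length cs) a \<Longrightarrow> eval_arr a s n (env @ env') cs = eval_arr a s n env cs"
  "wf_cond ar (length env) p \<Longrightarrow> eval_cond p s n (env @ env') = eval_cond p s n env"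
proof (induct e and a and p arbitrary: env and env cs and env rule: expr.induct arr.induct cond.induct)
  case (Read a es)
  have "map (\<lambda>e. eval e s n (env @ env')) es = map (\<lambda>e. eval e s n env) es"
    using Read by simp
  then show ?case using Read.hyps(1)[of env "map (\<lambda>e. eval e s n env) es"] Read.prems
    by (simp del: map_eq_conv)
next
  case (Lam j e)
  then show ?case using Lam.hyps[of "cs @ env"] by auto
next
  case (AllIn e1 e2 p)
  have "eval_cond p s n (m # env @ env') = eval_cond p s n (m # env)" for m
    using AllIn.hyps(3)[of "m # env"] AllIn.prems by auto
  then show ?case using AllIn by auto
qed (auto simp: nth_append)

text \<open>\<open>zs\<close> holds the values of the \<open>k\<close> new bound scalars, inserted
  at depth \<open>d\<close>. In the \<open>Lam\<close> case well-formedness gives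
  \<open>j = length cs\<close>, so \<open>cs @ env\<close> has exactly the length of the new
  threshold \<open>j + d\<close>.\<close>

lemma eval_lift:
  "wf_expr ar D e \<Longrightarrow> length env = d \<Longrightarrow> length zs = k \<Longrightarrow>
     eval (lift k d e) s n (env @ zs @ env') = eval e s n (env @ env')"
  "wf_arr ar D (length cs) a \<Longrightarrow> length env = d \<Longrightarrow> length zs = k \<Longrightarrow>
     eval_arr (lift_arr k d a) s n (env @ zs @ env') cs = eval_arr a s n (env @ env') cs"
  "wf_cond ar D p \<Longrightarrow> length env = d \<Longrightarrow> length zs = k \<Longrightarrow>
     eval_cond (lift_cond k d p) s n (env @ zs @ env') = eval_cond p s n (env @ env')"
proof (induct e and a and p arbitrary: env d D and env d D cs and env d D rule: expr.induct arr.induct cond.induct)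
  case (Bnd i)
  then show ?case by (auto simp: nth_append)
next
  case (Read a es)
  have "map (\<lambda>e. eval (lift k d e) s n (env @ zs @ env')) es = map (\<lambda>e. eval e s n (env @ env')) es"
    using Read by auto
  then show ?case
    using Read.hyps(1)[of D "map (\<lambda>e. eval e s n (env @ env')) es" env d] Read.prems
    by (simp del: map_eq_conv add: comp_def)
next
  case (Lam j e)
  then show ?case using Lam.hyps[of "length cs + D" "cs @ env" "length cs + d"] by auto
next
  case (Conj ps)
  have "eval_cond (lift_cond k d p) s n (env @ zs @ env') = eval_cond p s n (env @ env')" if "p \<in> set ps" for p
    using Conj.hyps[OF that, of D env d] Conj.prems that by auto
  then show ?case by simp
next
  case (AllIn e1 e2 p)
  have "eval_cond (lift_cond k (Suc d) p) s n (m # env @ zs @ env') = eval_cond p s n (m # env @ env')" for m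
    using AllIn.hyps(3)[of "Suc D" "m # env" "Suc d"] AllIn.prems by auto
  then show ?case using AllIn.hyps(1,2)[of D env d] AllIn.prems by auto
qed auto

lemma wf_lift:
  "wf_expr ar D e \<Longrightarrow> d \<le> D \<Longrightarrow> wf_expr ar (k + D) (lift k d e)"
  "wf_arr ar D j a \<Longrightarrow> d \<le> D \<Longrightarrow> wf_arr ar (k + D) j (lift_arr k d a)"
  "wf_cond ar D p \<Longrightarrow> d \<le> D \<Longrightarrow> wf_cond ar (k + D) (lift_cond k d p)"
proof (induct e and a and p arbitrary: D d and D d j and D d rule: expr.induct arr.induct cond.induct)
  case (Lam i e)
  then show ?case using Lam.hyps[of "j + D" "j + d"] by (auto simp: ac_simps)
next
  case (AllIn e1 e2 p)
  then show ?case using AllIn.hyps(3)[of "Suc D" "Suc d"] by auto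
qed auto

text \<open>Under a binder \<open>t\<close> is lifted and thus keeps the value it has outside, so a
  single value of \<open>n\<close> serves the whole expression.\<close>

lemma eval_nsubst:
  "wf_expr ar D e \<Longrightarrow> wf_expr ar D t \<Longrightarrow>
     eval (nsubst t e) s n env = eval e s (eval t s n env) env"
  "wf_arr ar D (length cs) a \<Longrightarrow> wf_expr ar D t \<Longrightarrow>
     eval_arr (nsubst_arr t a) s n env cs = eval_arr a s (eval t s n env) env cs"
  "wf_cond ar D p \<Longrightarrow> wf_expr ar D t \<Longrightarrow>
     eval_cond (nsubst_cond t p) s n env = eval_cond p s (eval t s n env) env"
proof (induct e and a and p arbitrary: env t D and env t D cs and env t D rule: expr.induct arr.induct cond.induct)
  case (Read a es)
  have "map (\<lambda>e. eval (nsubst t e) s n env) es = map (\<lambda>e. eval e s (eval t s n env) env) es"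
    using Read by auto
  then show ?case
    using Read.hyps(1)[of D "map (\<lambda>e. eval e s (eval t s n env) env) es" t env] Read.prems
    by (simp del: map_eq_conv add: comp_def)
next
  case (Lam j e)
  have "eval (lift j 0 t) s n (cs @ env) = eval t s n env"
    using eval_lift(1)[of ar D t "[]" 0 cs j] Lam.prems by auto
  then show ?case
    using Lam.hyps[of "j + D" "lift j 0 t" "cs @ env"] Lam.prems wf_lift(1)[of ar D t 0 j] by auto
next
  case (Conj ps)
  have "eval_cond (nsubst_cond t p) s n env = eval_cond p s (eval t s n env) env" if "p \<in> set ps" for p
    using Conj.hyps[OF that, of D t env] Conj.prems that by auto
  then show ?case by simp
next
  case (AllIn e1 e2 p)
  have "eval (lift 1 0 t) s n (m # env) = eval t s n env" for m
    using eval_lift(1)[of ar D t "[]" 0 "[m]" 1] AllIn.prems by auto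
  then have "eval_cond (nsubst_cond (lift 1 0 t) p) s n (m # env)
      = eval_cond p s (eval t s n env) (m # env)" for m
    using AllIn.hyps(3)[of "Suc D" "lift 1 0 t" "m # env"] AllIn.prems wf_lift(1)[of ar D t 0 1] by auto
  then show ?case using AllIn.hyps(1,2)[of D t env] AllIn.prems by auto
qed auto

lemma wf_nsubst:
  "wf_expr ar D e \<Longrightarrow> wf_expr ar D t \<Longrightarrow> wf_expr ar D (nsubst t e)"
  "wf_arr ar D j a \<Longrightarrow> wf_expr ar D t \<Longrightarrow> wf_arr ar D j (nsubst_arr t a)"
  "wf_cond ar D p \<Longrightarrow> wf_expr ar D t \<Longrightarrow> wf_cond ar D (nsubst_cond t p)"
proof (induct e and a and p arbitrary: D t and D t j and D t rule: expr.induct arr.induct cond.induct)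
  case (Lam i e)
  then show ?case using wf_lift(1)[of ar D t 0 j] by auto
next
  case (AllIn e1 e2 p)
  then show ?case using wf_lift(1)[of ar D t 0 1] by auto
qed auto

text \<open>The premise on \<open>\<sigma>\<close> covers every environment, because substituted
  arrays are placed under binders unchanged, and index vectors of length \<open>ar x\<close>,
  because well-formed reads of \<open>x\<close> use only these.\<close>

lemma eval_vsubst:
  assumes "\<And>x env cs. length cs = ar x \<Longrightarrow> eval_arr (\<sigma> x) s n env cs = s' x cs"
  shows "wf_expr ar D e \<Longrightarrow> eval (vsubst \<sigma> e) s n env = eval e s' n env"
    and "wf_arr ar D (length cs) a \<Longrightarrow> eval_arr (vsubst_arr \<sigma> a) s n env cs = eval_arr a s' n env cs"
    and "wf_cond ar D p \<Longrightarrow> eval_cond (vsubst_cond \<sigma> p) s n env = eval_cond p s' n env"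
proof (induct e and a and p arbitrary: env D and env D cs and env D rule: expr.induct arr.induct cond.induct)
  case (Read a es)
  have "map (\<lambda>e. eval (vsubst \<sigma> e) s n env) es = map (\<lambda>e. eval e s' n env) es"
    using Read by auto
  then show ?case
    using Read.hyps(1)[of D "map (\<lambda>e. eval e s' n env) es" env] Read.prems
    by (simp del: map_eq_conv add: comp_def)
next
  case (Conj ps)
  have "eval_cond (vsubst_cond \<sigma> p) s n env = eval_cond p s' n env" if "p \<in> set ps" for p
    using Conj.hyps[OF that, of D env] Conj.prems that by auto
  then show ?case by simp
next
  case (AllIn e1 e2 p)
  then show ?case using AllIn.hyps(1,2)[of D env] AllIn.hyps(3)[of "Suc D"] by auto
qed (auto simp: assms)

lemma wf_vsubst:
  assumes "\<And>x D. wf_arr ar D (ar x) (\<sigma> x)"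
  shows "wf_expr ar D e \<Longrightarrow> wf_expr ar D (vsubst \<sigma> e)"
    and "wf_arr ar D j a \<Longrightarrow> wf_arr ar D j (vsubst_arr \<sigma> a)"
    and "wf_cond ar D p \<Longrightarrow> wf_cond ar D (vsubst_cond \<sigma> p)"
  by (induct e and a and p arbitrary: D and D j and D rule: expr.induct arr.induct cond.induct)
    (auto simp: assms)

section \<open>Direct semantics of rvalues and index vectors\<close>

text \<open>Rvalues contain neither \<open>n\<close> nor bound scalars, so their value depends on
  the state alone.\<close>

fun rval_sem :: "'v state \<Rightarrow> 'v rval \<Rightarrow> int" where
  "rval_sem s (Num c) = c"
| "rval_sem s (Op b r1 r2) = binop_sem b (rval_sem s r1) (rval_sem s r2)"
| "rval_sem s (Lv x rs) = s x (map (rval_sem s) rs)"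

lemma eval_expr_of [simp]: "eval (expr_of r) s n env = rval_sem s r"
proof (induct r)
  case (Lv x rs)
  then have "map ((\<lambda>e. eval e s n env) \<circ> expr_of) rs = map (rval_sem s) rs" by auto
  then show ?case by (simp del: map_eq_conv)
qed auto

lemma wf_expr_of: "wf_rval ar r \<Longrightarrow> wf_expr ar D (expr_of r)"
  by (induct r) auto

lemma eval_vec_eq:
  "length es = length es' \<Longrightarrow>
     eval_cond (vec_eq es es') s n env \<longleftrightarrow> map (\<lambda>e. eval e s n env) es = map (\<lambda>e. eval e s n env) es'"
  unfolding vec_eq_def by (induct es es' rule: list_induct2) auto

lemma wf_vec_eq:
  "(\<forall>e\<in>set es. wf_expr ar D e) \<Longrightarrow> (\<forall>e\<in>set es'. wf_expr ar D e) \<Longrightarrow> wf_cond ar D (vec_eq es es')"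
  unfolding vec_eq_def by (induct es es' rule: list_induct2') auto

lemma map_eval_Bnd: "map ((\<lambda>e. eval e s n (cs @ env)) \<circ> Bnd) [0..<length cs] = cs"
  by (rule nth_equalityI) (auto simp: nth_append)

section \<open>Iterating the loop body\<close>

text \<open>One iteration as a state transformer, the semantic counterpart of \<open>up_arr\<close>.
  All rvalues are evaluated in the old state \<open>s\<close>, which makes the update
  simultaneous.\<close>

fun exec :: "('v lval \<times> 'v rval) list \<Rightarrow> 'v state \<Rightarrow> 'v state" where
  "exec [] s x cs = s x cs"
| "exec (((y, rs), r) # as) s x cs =
     (if y = x \<and> map (rval_sem s) rs = cs then rval_sem s r else exec as s x cs)"

abbreviation wf_assigns :: "('v \<Rightarrow> nat) \<Rightarrow> ('v lval \<times> 'v rval) list \<Rightarrow> bool" where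
  "wf_assigns ar as \<equiv> \<forall>((x, rs), r) \<in> set as. wf_rval ar (Lv x rs) \<and> wf_rval ar r"

text \<open>The array for the tail of the list sits inside the \<open>Lam\<close> and is evaluated
  in \<open>cs @ env\<close>; the induction therefore needs all environments.\<close>

lemma eval_up_arr:
  "wf_assigns ar as \<Longrightarrow> length cs = ar x \<Longrightarrow> eval_arr (up_arr ar as x) s n env cs = exec as s x cs"
proof (induct as arbitrary: env)
  case (Cons a as)
  obtain y rs r where a: "a = ((y, rs), r)" by (cases a) auto
  have idx: "map (\<lambda>e. eval e s n (cs @ env)) (map Bnd [0..<ar x]) = cs"
    using map_eval_Bnd[of s n cs env] Cons.prems(2) by simp
  have expr_of: "map (\<lambda>e. eval e s n (cs @ env)) (map expr_of rs) = map (rval_sem s) rs" by simp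
  have "length rs = ar y" using Cons.prems(1) a by auto
  then have test: "eval_cond (vec_eq (map Bnd [0..<ar x]) (map expr_of rs)) s n (cs @ env)
      \<longleftrightarrow> cs = map (rval_sem s) rs" if "y = x"
    using that by (subst eval_vec_eq) (simp_all only: expr_of idx length_map length_upt diff_zero)
  have IH: "eval_arr (up_arr ar as x) s n env' cs = exec as s x cs" for env'
    using Cons by simp
  show ?case using test by (simp add: a IH idx del: map_map)
qed simp

lemma wf_up_arr: "wf_assigns ar as \<Longrightarrow> wf_arr ar D (ar x) (up_arr ar as x)"
proof (induct as arbitrary: D)
  case (Cons a as)
  then show ?case by (cases a) (auto intro!: wf_vec_eq wf_expr_of)
qed simp

text \<open>The innermost \<open>up\<close> is peeled off: by induction \<open>up e\<close> is
  evaluated in the state after \<open>k\<close> iterations, and this one substitution turns into one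
  more \<open>exec\<close> step. Hence \<open>e\<close> varies in the induction.\<close>

lemma eval_up_funpow:
  assumes "wf_assigns ar (assigns T)"
  shows "wf_expr ar D e \<Longrightarrow> eval ((up ar T ^^ k) e) s n env = eval e ((exec (assigns T) ^^ k) s) n env"
    and "wf_arr ar D (length cs) a \<Longrightarrow>
      eval_arr ((up_on_arr ar T ^^ k) a) s n env cs = eval_arr a ((exec (assigns T) ^^ k) s) n env cs"
proof -
  let ?u = "up_arr ar (assigns T)"
  have u: "length cs = ar x \<Longrightarrow> eval_arr (?u x) s n env cs = exec (assigns T) s x cs" for s x n env cs
    using assms by (rule eval_up_arr)
  have w: "wf_arr ar D (ar x) (?u x)" for D x
    using assms by (rule wf_up_arr)
  show "wf_expr ar D e \<Longrightarrow> eval ((up ar T ^^ k) e) s n env = eval e ((exec (assigns T) ^^ k) s) n env"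
  proof (induct k arbitrary: e)
    case (Suc k)
    have "eval ((up ar T ^^ Suc k) e) s n env = eval ((up ar T ^^ k) (up ar T e)) s n env"
      by (simp add: funpow_swap1)
    also have "\<dots> = eval (up ar T e) ((exec (assigns T) ^^ k) s) n env"
      by (intro Suc wf_vsubst(1) w)
    also have "\<dots> = eval e ((exec (assigns T) ^^ Suc k) s) n env"
      using eval_vsubst(1)[OF u Suc.prems] by simp
    finally show ?case .
  qed simp
  show "wf_arr ar D (length cs) a \<Longrightarrow>
      eval_arr ((up_on_arr ar T ^^ k) a) s n env cs = eval_arr a ((exec (assigns T) ^^ k) s) n env cs"
  proof (induct k arbitrary: a)
    case (Suc k)
    have "eval_arr ((up_on_arr ar T ^^ Suc k) a) s n env cs
        = eval_arr ((up_on_arr ar T ^^ k) (up_on_arr ar T a)) s n env cs"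
      by (simp add: funpow_swap1)
    also have "\<dots> = eval_arr (up_on_arr ar T a) ((exec (assigns T) ^^ k) s) n env cs"
      by (intro Suc wf_vsubst(2) w)
    also have "\<dots> = eval_arr a ((exec (assigns T) ^^ Suc k) s) n env cs"
      using eval_vsubst(2)[OF u Suc.prems] by simp
    finally show ?case .
  qed simp
qed

section \<open>The last write to a cell\<close>

text \<open>Assignments to other variables never match, and \<open>find\<close> respects the
  precedence of the first match. This is the one-step recurrence that \<open>last_hit\<close>
  expects.\<close>

lemma exec_eq_find:
  "exec (assigns T) s x cs =
     (case find (\<lambda>(rs, r). map (rval_sem s) rs = cs) (assigns_of T x) of
        None \<Rightarrow> s x cs | Some (rs, r) \<Rightarrow> rval_sem s r)"
proof -
  have "exec as s x cs =
     (case find (\<lambda>(rs, r). map (rval_sem s) rs = cs)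
        (map (\<lambda>((y, rs), r). (rs, r)) (filter (\<lambda>((y, rs), r). y = x) as)) of
        None \<Rightarrow> s x cs | Some (rs, r) \<Rightarrow> rval_sem s r)" for as
    by (induct as) auto
  then show ?thesis by (simp add: assigns_of_def)
qed

text \<open>Intended reading: \<open>hit k a\<close> means that the assignment \<open>a\<close> matches in iteration \<open>k + 1\<close>, and
  \<open>E a\<close> stands for \<open>inst\<close>, which need only be correct for assignments that do have a last match.\<close>

lemma last_hit:
  fixes f :: "nat \<Rightarrow> 'b" and E :: "'a \<Rightarrow> int"
  assumes step: "\<And>k. f (Suc k) = (case find (hit k) L of None \<Rightarrow> f k | Some a \<Rightarrow> g k a)"
    and E: "\<And>k a. a \<in> set L \<Longrightarrow> k < n \<Longrightarrow> hit k a \<Longrightarrow> \<forall>k'\<in>{k<..<n}. \<not> hit k' a \<Longrightarrow> E a = int k + 1"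
  shows "f n = (case find (\<lambda>a. \<exists>k<n. E a = int k + 1 \<and> hit k a \<and>
                     (\<forall>k'\<in>{k<..<n}. \<forall>b\<in>set L. \<not> hit k' b)) L of
           None \<Rightarrow> f 0 | Some a \<Rightarrow> g (nat (E a - 1)) a)"
    (is "_ = (case find ?P L of None \<Rightarrow> _ | Some a \<Rightarrow> _ a)")
proof -
  have const: "f j = f i" if "i \<le> j" "\<forall>k\<in>{i..<j}. \<forall>b\<in>set L. \<not> hit k b" for i j
    using that
  proof (induct j rule: dec_induct)
    case (step j)
    then have "find (hit j) L = None" by (auto simp: find_None_iff)
    with step assms(1)[of j] show ?case by auto
  qed simp
  let ?H = "{k. k < n \<and> (\<exists>b\<in>set L. hit k b)}"
  show ?thesis
  proof (cases "?H = {}")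
    case True
    then have "find ?P L = None" by (auto simp: find_None_iff)
    moreover have "f n = f 0" using True by (intro const) auto
    ultimately show ?thesis by simp
  next
    case False
    \<comment> \<open>Iteration \<open>m + 1\<close> is the last one in which any assignment
      matches.\<close>
    define m where "m = Max ?H"
    have fin: "finite ?H" by simp
    have m: "m < n" "\<exists>b\<in>set L. hit m b" using Max_in[OF fin False] by (auto simp: m_def)
    have later: "\<not> hit k b" if "m < k" "k < n" "b \<in> set L" for k b
    proof
      assume "hit k b"
      with that have "k \<in> ?H" by blast
      then have "k \<le> m" unfolding m_def by (rule Max_ge[OF fin])
      with that show False by simp
    qed
    \<comment> \<open>The witness \<open>k\<close> in \<open>?P a\<close> can only be
      \<open>m\<close>: a match after \<open>m\<close> is excluded by maximality, and one before
      \<open>m\<close> by the clause on later matches of all assignments.\<close>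
    have P: "?P a \<longleftrightarrow> hit m a" if "a \<in> set L" for a
    proof
      assume "?P a"
      then obtain k where k: "k < n" "hit k a" "\<forall>k'\<in>{k<..<n}. \<forall>b\<in>set L. \<not> hit k' b" by auto
      then have "k = m" using later[of k a] m that by (metis greaterThanLessThan_iff linorder_neqE_nat)
      with k show "hit m a" by simp
    next
      assume "hit m a"
      with E[OF that m(1)] later that m(1) show "?P a" by (intro exI[of _ m]) auto
    qed
    have "find ?P L = find (hit m) L" using P by (rule find_cong[OF refl])
    moreover obtain a where a: "find (hit m) L = Some a"
      using m(2) by (cases "find (hit m) L") (auto simp: find_None_iff)
    then have "a \<in> set L" "hit m a" by (auto simp: find_Some_iff)
    \<comment> \<open>Thus \<open>nat (E a - 1)\<close> is \<open>m\<close>, the index of the state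
      from which the final write is computed.\<close>
    then have "E a = int m + 1" using E[OF _ m(1)] later by auto
    moreover have "f n = f (Suc m)" using m(1) later by (intro const) auto
    ultimately show ?thesis using a step[of m] by simp
  qed
qed

section \<open>Evaluating the closed form\<close>

lemma assigns_of_iff: "(rs, r) \<in> set (assigns_of T x) \<longleftrightarrow> ((x, rs), r) \<in> set (assigns T)"
  by (force simp: assigns_of_def)

text \<open>Replacing top-level lvalues by their closed forms suffices, since the operators above
  them commute with passing to the state after \<open>k\<close> iterations.\<close>

lemma eval_cf_rval:
  assumes "wf_assigns ar (assigns T)"
    and "\<forall>l \<in> Lval r. closed_form_lval ar T l (cf l)"
    and "wf_rval ar r"
  shows "eval (cf_rval cf r) s (int k) env = rval_sem ((exec (assigns T) ^^ k) s) r"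
  using assms(2,3)
proof (induct r)
  case (Lv x rs)
  then have cf: "closed_form_lval ar T (x, rs) (cf (x, rs))" by simp
  then have "eval (cf (x, rs)) s (int k) env = eval (cf (x, rs)) s (int k) []"
    using eval_append_env(1)[of ar "[]"] by (simp add: closed_form_lval_def)
  also have "\<dots> = eval (expr_of (Lv x rs)) ((exec (assigns T) ^^ k) s) (int k) []"
    using cf eval_up_funpow(1)[OF assms(1) wf_expr_of[OF Lv.prems(2)]]
    unfolding closed_form_lval_def by auto
  finally show ?case by (simp only: cf_rval.simps eval_expr_of)
qed auto

lemma wf_cf_rval:
  assumes "\<forall>l \<in> Lval r. closed_form_lval ar T l (cf l)"
  shows "wf_expr ar D (cf_rval cf r)"
  using assms by (induct r) (auto simp: closed_form_lval_def intro: wf_expr_mono(1)[of _ 0])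

lemma wf_cf_at:
  assumes "\<forall>l \<in> Lval r. closed_form_lval ar T l (cf l)" and "wf_expr ar D t"
  shows "wf_expr ar D (cf_at cf r t)"
  unfolding cf_at_def by (intro wf_nsubst(1) wf_cf_rval[OF assms(1)] assms(2))

text \<open>Closed forms are specified at natural values of \<open>n\<close> only, hence the premise
  that \<open>t\<close> evaluates to some \<open>int k\<close>.\<close>

lemma eval_cf_at:
  assumes "wf_assigns ar (assigns T)"
    and "\<forall>l \<in> Lval r. closed_form_lval ar T l (cf l)"
    and "wf_rval ar r" and "wf_expr ar D t" and "eval t s n env = int k"
  shows "eval (cf_at cf r t) s n env = rval_sem ((exec (assigns T) ^^ k) s) r"
  unfolding cf_at_def
  by (simp add: eval_nsubst(1)[OF wf_cf_rval[OF assms(2)] assms(4)] assms(5) eval_cf_rval[OF assms(1-3)])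

lemma wf_written:
  assumes "\<forall>r\<in>set rs. \<forall>l \<in> Lval r. closed_form_lval ar T l (cf l)"
    and "wf_expr ar D m" and "\<forall>e\<in>set es. wf_expr ar D e"
  shows "wf_cond ar D (written cf rs m es)"
  unfolding written_def using assms by (intro wf_vec_eq) (auto intro!: wf_cf_at[where T = T])

text \<open>Iteration \<open>m = k + 1\<close> computes its index vectors in the state reached after
  \<open>k\<close> iterations; this is the offset in \<open>written\<close>.\<close>

lemma eval_written:
  assumes "wf_assigns ar (assigns T)"
    and "\<forall>r\<in>set rs. \<forall>l \<in> Lval r. closed_form_lval ar T l (cf l)"
    and "\<forall>r\<in>set rs. wf_rval ar r" and "wf_expr ar D m" and "eval m s n env = int k + 1"
    and "length es = length rs"
  shows "eval_cond (written cf rs m es) s n env \<longleftrightarrow>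
    map (rval_sem ((exec (assigns T) ^^ k) s)) rs = map (\<lambda>e. eval e s n env) es"
proof -
  have "map (\<lambda>e. eval e s n env) (map (\<lambda>r. cf_at cf r (Bin Minus m (Const 1))) rs)
      = map (rval_sem ((exec (assigns T) ^^ k) s)) rs"
    using assms by (auto intro!: eval_cf_at[where T = T and ar = ar and D = D])
  then show ?thesis
    unfolding written_def using assms(6) by (subst eval_vec_eq) (auto simp del: map_map map_eq_conv)
qed

text \<open>Iterations count from 1 in \<open>last_write\<close> and states count from 0, so the
  interval from \<open>e + 1\<close> to \<open>n\<close> becomes \<open>{k<..<n}\<close>.\<close>

lemma eval_last_write:
  assumes "wf_assigns ar (assigns T)"
    and "\<forall>(rs, r) \<in> set (assigns_of T x). \<forall>r\<in>set rs. \<forall>l \<in> Lval r. closed_form_lval ar T l (cf l)"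
    and "(rs, r) \<in> set (assigns_of T x)"
    and "wf_expr ar (ar x) e" and "eval e s (int n) cs = int k + 1" and "length cs = ar x"
  shows "eval_cond (last_write cf T x rs e Nvar (map Bnd [0..<ar x])) s (int n) cs \<longleftrightarrow>
    map (rval_sem ((exec (assigns T) ^^ k) s)) rs = cs \<and>
    (\<forall>k'\<in>{k<..<n}. \<forall>(rs', r')\<in>set (assigns_of T x).
       map (rval_sem ((exec (assigns T) ^^ k') s)) rs' \<noteq> cs)"
proof -
  let ?S = "\<lambda>k. (exec (assigns T) ^^ k) s"
  let ?cs = "map Bnd [0..<ar x] :: 'a expr list"
  have len: "length rs' = ar x" "\<forall>r\<in>set rs'. wf_rval ar r" if "(rs', r') \<in> set (assigns_of T x)" for rs' r'
    using assms(1) that by (auto simp: assigns_of_iff)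
  have w1: "eval_cond (written cf rs e ?cs) s (int n) cs \<longleftrightarrow> map (rval_sem (?S k)) rs = cs"
    using assms len[OF assms(3)] map_eval_Bnd[of s "int n" cs "[]"]
    by (subst eval_written[where T = T and k = k]) (auto simp: comp_def)
  \<comment> \<open>Lifting skips the scalar \<open>m\<close> bound by \<open>AllIn\<close>, so the
    indices still denote \<open>cs\<close>.\<close>
  have sh: "map (\<lambda>e. eval e s (int n) (m # cs)) (map (lift 1 0) ?cs) = cs" for m
    by (rule nth_equalityI) (auto simp: assms(6))
  have w2: "eval_cond (written cf rs' (Bnd 0) (map (lift 1 0) ?cs)) s (int n) ((int k' + 1) # cs)
      \<longleftrightarrow> map (rval_sem (?S k')) rs' = cs" if "(rs', r') \<in> set (assigns_of T x)" for rs' r' k'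
    using assms(1,2) len[OF that] that sh[of "int k' + 1"]
    by (subst eval_written[where T = T and k = k' and D = 1 and ar = ar]) (auto simp del: map_map)
  \<comment> \<open>Passes from integer iteration numbers \<open>m\<close> to state indices
    \<open>k' = m - 1\<close>, which are natural as \<open>m\<close> is at least 2.\<close>
  have re: "(\<forall>m\<in>{int k + 2..int n}. Q m) \<longleftrightarrow> (\<forall>k'\<in>{k<..<n}. Q (int k' + 1))" for Q
  proof
    assume R: "\<forall>k'\<in>{k<..<n}. Q (int k' + 1)"
    show "\<forall>m\<in>{int k + 2..int n}. Q m"
    proof
      fix m assume "m \<in> {int k + 2..int n}"
      then have "nat (m - 1) \<in> {k<..<n}" "m = int (nat (m - 1)) + 1" by auto
      with R show "Q m" by metis
    qed
  qed auto
  have "eval_cond (notwritten cf T x (Bin Plus e (Const 1)) Nvar ?cs) s (int n) cs \<longleftrightarrow>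
      (\<forall>(rs', r')\<in>set (assigns_of T x). \<forall>m\<in>{int k + 2..int n}.
         \<not> eval_cond (written cf rs' (Bnd 0) (map (lift 1 0) ?cs)) s (int n) (m # cs))"
    unfolding notwritten_def using assms(5)
    by (simp add: split_beta add.commute del: map_map)
  also have "\<dots> \<longleftrightarrow> (\<forall>(rs', r')\<in>set (assigns_of T x). \<forall>k'\<in>{k<..<n}.
       map (rval_sem (?S k')) rs' \<noteq> cs)"
    unfolding re using w2 by (intro ball_cong refl) auto
  finally show ?thesis
    unfolding last_write_def using w1 by auto
qed

section \<open>Constant displacements and the iteration of the last write\<close>

text \<open>The displacement is the same in every state, in particular in each state reached by the
  loop, so the differences add up to \<open>k * d\<close>. Validity compares whole lists and thereby
  also fixes the length of \<open>d\<close>.\<close>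

lemma displacement_eq:
  assumes "displacement ar T rs d" "wf_assigns ar (assigns T)" "\<forall>r\<in>set rs. wf_rval ar r"
  shows "length d = length rs"
    and "i < length rs \<Longrightarrow>
      rval_sem ((exec (assigns T) ^^ k) s) (rs ! i) = rval_sem s (rs ! i) + int k * d ! i"
proof -
  have D: "map (\<lambda>e. eval e s 0 []) (map2 (Bin Minus) (up_vec ar T rs) (map expr_of rs)) =
      map (\<lambda>e. eval e s 0 []) (map Const d)" for s
    using assms(1) unfolding displacement_def valid_def by (metis of_nat_0)
  from arg_cong[OF D, of length] show len: "length d = length rs" by simp
  assume i: "i < length rs"
  have up: "eval (up ar T (expr_of (rs ! i))) s 0 [] = rval_sem (exec (assigns T) s) (rs ! i)" for s
    using eval_up_funpow(1)[OF assms(2) wf_expr_of, of "rs ! i" 1 s 0 "[]"] assms(3) i by auto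
  have step: "rval_sem (exec (assigns T) s) (rs ! i) = rval_sem s (rs ! i) + d ! i" for s
    using arg_cong[OF D, of "\<lambda>v. v ! i" s] i len up by simp
  show "rval_sem ((exec (assigns T) ^^ k) s) (rs ! i) = rval_sem s (rs ! i) + int k * d ! i"
    by (induct k) (auto simp: step algebra_simps)
qed

lemma wf_inst:
  assumes "length rs = ar x" "\<forall>r\<in>set rs. wf_rval ar r" "length d = ar x"
    and "(\<exists>j < length d. d ! j \<noteq> 0) \<longrightarrow> i < length d"
  shows "wf_expr ar (ar x) (inst rs d i (map Bnd [0..<ar x]))"
  using assms by (auto simp: inst_def intro!: wf_expr_of)

text \<open>For a nonzero \<open>d ! i\<close> the dividend is exactly \<open>k * d ! i\<close>, so
  rounding has no effect and the quotient is \<open>k\<close>.\<close>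

lemma eval_inst:
  assumes disp: "displacement ar T rs d" and wf: "wf_assigns ar (assigns T)" "\<forall>r\<in>set rs. wf_rval ar r"
    and len: "length rs = ar x"
    and i: "(\<exists>j < length d. d ! j \<noteq> 0) \<longrightarrow> i < length d \<and> d ! i \<noteq> 0"
    and "k < n" and hit: "map (rval_sem ((exec (assigns T) ^^ k) s)) rs = cs"
    and last: "\<forall>k'\<in>{k<..<n}. map (rval_sem ((exec (assigns T) ^^ k') s)) rs \<noteq> cs"
  shows "eval (inst rs d i (map Bnd [0..<ar x])) s (int n) cs = int k + 1"
proof (cases "\<exists>j < length d. d ! j \<noteq> 0")
  case True
  then have i: "i < length rs" "d ! i \<noteq> 0" using i displacement_eq(1)[OF disp wf] by auto
  have "cs ! i = rval_sem s (rs ! i) + int k * d ! i"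
    using displacement_eq(2)[OF disp wf i(1)] i(1) by (simp flip: hit)
  with True i len show ?thesis by (simp add: inst_def)
next
  case False
  \<comment> \<open>With zero displacement one match means a match in every iteration, so the last
    one before \<open>n\<close> is at \<open>k = n - 1\<close>.\<close>
  have "map (rval_sem ((exec (assigns T) ^^ k') s)) rs = cs" for k'
    unfolding hit[symmetric]
    using False displacement_eq[OF disp wf] by (intro nth_equalityI) auto
  then have "\<not> (k < n - 1 \<and> n - 1 < n)" using last by auto
  with False \<open>k < n\<close> show ?thesis by (auto simp: inst_def)
qed

section \<open>Agreement of the closed form with the iterated update\<close>

theorem theorem3:
  fixes ar :: "'v \<Rightarrow> nat" and T :: "'v loop" and x :: 'v
    and cf :: "'v lval \<Rightarrow> 'v expr"
    and d :: "'v rval list \<Rightarrow> int list" and pick :: "'v rval list \<Rightarrow> nat"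
  assumes "countable (UNIV :: 'v set)" and "infinite (UNIV :: 'v set)"
    and "wf_loop ar T"
    and "a_solvable ar T"
    and "\<exists>\<theta>. rec_solution (recurrences ar T) \<theta>"
    and "\<forall>l \<in> cf_lvals T. closed_form_lval ar T l (cf l)"
    and "\<forall>(rs, r) \<in> set (assigns_of T x). displacement ar T rs (d rs)"
    and "\<forall>(rs, r) \<in> set (assigns_of T x).
           (\<exists>j < length (d rs). d rs ! j \<noteq> 0) \<longrightarrow> pick rs < length (d rs) \<and> d rs ! pick rs \<noteq> 0"
  shows "closed_form_var ar T x (array_closed_form ar T cf d pick x)"
proof -
  let ?L = "assigns_of T x"
  let ?cs = "map Bnd [0..<ar x] :: 'v expr list"
  let ?e = "\<lambda>rs. inst rs (d rs) (pick rs) ?cs"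
  let ?G = "\<lambda>rs. Conj [Cmp LEQ (Const 1) (?e rs), Cmp LEQ (?e rs) Nvar, last_write cf T x rs (?e rs) Nvar ?cs]"
  let ?V = "\<lambda>rs r. cf_at cf r (Bin Minus (?e rs) (Const 1))"
  let ?F = "\<lambda>L. foldr (\<lambda>(rs, r) e'. Ite (?G rs) (?V rs r) e') L (Read (Var x) ?cs)"
  have acf: "array_closed_form ar T cf d pick x = Lam (ar x) (?F ?L)"
    by (simp add: array_closed_form_def Let_def)
  have wf: "wf_assigns ar (assigns T)" using assms(3) by (auto simp: wf_loop_def)
  have wf_rs: "length rs = ar x" "\<forall>r\<in>set rs. wf_rval ar r" "wf_rval ar r"
    if "(rs, r) \<in> set ?L" for rs r
    using wf that by (auto simp: assigns_of_iff)
  have cf: "\<forall>r\<in>set rs. \<forall>l \<in> Lval r. closed_form_lval ar T l (cf l)"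
      "\<forall>l \<in> Lval r. closed_form_lval ar T l (cf l)" if "(rs, r) \<in> set ?L" for rs r
    using assms(6) that by (fastforce simp: assigns_of_iff cf_lvals_def)+
  have disp: "displacement ar T rs (d rs)" if "(rs, r) \<in> set ?L" for rs r
    using assms(7) that by auto
  have pick: "(\<exists>j < length (d rs). d rs ! j \<noteq> 0) \<longrightarrow> pick rs < length (d rs) \<and> d rs ! pick rs \<noteq> 0"
    if "(rs, r) \<in> set ?L" for rs r
    using assms(8) that by auto
  have wf_e: "wf_expr ar (ar x) (?e rs)" if "(rs, r) \<in> set ?L" for rs r
    using wf_rs[OF that] displacement_eq(1)[OF disp[OF that] wf] pick[OF that] by (intro wf_inst) auto
  have wf_G: "wf_cond ar (ar x) (?G rs)" if "(rs, r) \<in> set ?L" for rs r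
    using wf_e[OF that] cf that
    by (auto simp: last_write_def notwritten_def intro!: wf_written[where T = T])
  \<comment> \<open>The cases are peeled off one by one while every guard still refers to all of
    \<open>?L\<close> through \<open>last_write\<close>; hence the induction over lists
    \<open>L\<close> with elements from \<open>?L\<close>.\<close>
  have wf_F: "set L \<subseteq> set ?L \<Longrightarrow> wf_expr ar (ar x) (?F L)" for L
  proof (induct L)
    case (Cons a L)
    obtain rs r where a: "a = (rs, r)" by (cases a)
    with Cons.prems have "(rs, r) \<in> set ?L" by simp
    with Cons a wf_G wf_e cf show ?case by (auto intro!: wf_cf_at[where T = T] simp del: wf_cond.simps)
  qed simp
  have "eval_arr (Lam (ar x) (?F ?L)) s (int n) [] cs = (exec (assigns T) ^^ n) s x cs"
    if "length cs = ar x" for n s cs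
  proof -
    let ?S = "\<lambda>k. (exec (assigns T) ^^ k) s"
    let ?E = "\<lambda>rs. eval (?e rs) s (int n) cs"
    let ?hit = "\<lambda>k (rs, r :: 'v rval). map (rval_sem (?S k)) rs = cs"
    let ?P = "\<lambda>(rs, r). \<exists>k<n. ?E rs = int k + 1 \<and> ?hit k (rs, r) \<and>
                     (\<forall>k'\<in>{k<..<n}. \<forall>b\<in>set ?L. \<not> ?hit k' b)"
    \<comment> \<open>If \<open>?E rs\<close> lies outside 1 to \<open>n\<close>, both sides are
      false: a comparison fails, and no \<open>k < n\<close> has \<open>?E rs = int k + 1\<close>.
      Inside the range \<open>k = ?E rs - 1\<close> is natural and \<open>eval_last_write\<close>
      applies.\<close>
    have G: "eval_cond (?G rs) s (int n) cs \<longleftrightarrow> ?P (rs, r)" if "(rs, r) \<in> set ?L" for rs r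
    proof (cases "1 \<le> ?E rs \<and> ?E rs \<le> int n")
      case True
      define k where "k = nat (?E rs - 1)"
      have k: "?E rs = int k + 1" "k < n" using True by (auto simp: k_def)
      have "eval_cond (last_write cf T x rs (?e rs) Nvar ?cs) s (int n) cs \<longleftrightarrow>
          ?hit k (rs, r) \<and> (\<forall>k'\<in>{k<..<n}. \<forall>b\<in>set ?L. \<not> ?hit k' b)"
        using cf by (subst eval_last_write[OF wf _ that wf_e[OF that] k(1) \<open>length cs = ar x\<close>]) auto
      with True k show ?thesis by auto
    qed auto
    \<comment> \<open>\<open>?P\<close> guarantees that \<open>?E rs - 1\<close> is natural, as
      evaluating a closed form requires.\<close>
    have V: "eval (?V rs r) s (int n) cs = rval_sem (?S (nat (?E rs - 1))) r"
      if "(rs, r) \<in> set ?L" "?P (rs, r)" for rs r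
      using that wf_e[OF that(1)] cf[OF that(1)] wf_rs[OF that(1)]
      by (intro eval_cf_at[OF wf, where D = "ar x"]) auto
    \<comment> \<open>Nested conditionals take the first enabled case, which is the search performed
      by \<open>find ?P\<close>.\<close>
    have "set L \<subseteq> set ?L \<Longrightarrow> eval (?F L) s (int n) cs = (case find ?P L of
        None \<Rightarrow> s x cs | Some (rs, r) \<Rightarrow> rval_sem (?S (nat (?E rs - 1))) r)" for L
    proof (induct L)
      case Nil
      then show ?case using map_eval_Bnd[of s "int n" cs "[]"] that by simp
    next
      case (Cons a L)
      obtain rs r where a: "a = (rs, r)" by (cases a)
      with Cons.prems have "(rs, r) \<in> set ?L" by simp
      note G = G[OF this] and V = V[OF this]
      have "eval (?F (a # L)) s (int n) cs =
          (if ?P a then eval (?V rs r) s (int n) cs else eval (?F L) s (int n) cs)"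
        using G by (simp add: a del: eval_cond.simps)
      also have "\<dots> = (case find ?P (a # L) of
        None \<Rightarrow> s x cs | Some (rs, r) \<Rightarrow> rval_sem (?S (nat (?E rs - 1))) r)"
        using V Cons by (cases "?P a") (simp_all only: a find.simps if_True if_False option.case prod.case, auto)
      finally show ?case .
    qed
    also have "(case find ?P ?L of
        None \<Rightarrow> s x cs | Some (rs, r) \<Rightarrow> rval_sem (?S (nat (?E rs - 1))) r) = ?S n x cs"
    proof -
      have step: "?S (Suc k) x cs = (case find (?hit k) ?L of None \<Rightarrow> ?S k x cs
          | Some a \<Rightarrow> rval_sem (?S k) (snd a))" for k
        using exec_eq_find[of T "?S k" x cs] by (auto split: option.splits)
      \<comment> \<open>The premise only excludes later matches of \<open>a\<close> itself, which is
        what \<open>eval_inst\<close> uses; other assignments may still match later.\<close>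
      have E: "?E (fst a) = int k + 1"
        if "a \<in> set ?L" "k < n" "?hit k a" "\<forall>k'\<in>{k<..<n}. \<not> ?hit k' a" for k a
      proof -
        obtain rs r where a: "a = (rs, r)" by (cases a)
        with that have L: "(rs, r) \<in> set ?L" and
          "map (rval_sem (?S k)) rs = cs" "\<forall>k'\<in>{k<..<n}. map (rval_sem (?S k')) rs \<noteq> cs"
          by auto
        from eval_inst[OF disp[OF L] wf wf_rs(2)[OF L] wf_rs(1)[OF L] pick[OF L] that(2) this(2,3)]
        show ?thesis by (simp add: a)
      qed
      have P: "?P = (\<lambda>a. \<exists>k<n. ?E (fst a) = int k + 1 \<and> ?hit k a \<and>
                     (\<forall>k'\<in>{k<..<n}. \<forall>b\<in>set ?L. \<not> ?hit k' b))"
        by auto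
      have "?S n x cs = (case find ?P ?L of None \<Rightarrow> ?S 0 x cs
          | Some a \<Rightarrow> rval_sem (?S (nat (?E (fst a) - 1))) (snd a))"
        unfolding P
        by (rule last_hit[where f = "\<lambda>k. ?S k x cs" and hit = ?hit and L = ?L
            and g = "\<lambda>k a. rval_sem (?S k) (snd a)" and E = "\<lambda>a. ?E (fst a)"]) (fact step, fact E)
      also have "\<dots> = (case find ?P ?L of
          None \<Rightarrow> s x cs | Some (rs, r) \<Rightarrow> rval_sem (?S (nat (?E rs - 1))) r)"
        by (rule option.case_cong) (simp_all add: split_beta)
      finally show ?thesis by (rule sym)
    qed
    finally show ?thesis using that by simp
  qed
  then show ?thesis
    using eval_up_funpow(2)[OF wf, of 0 _ "Var x"] wf_F[of ?L]
    by (simp add: closed_form_var_def acf)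
qed

end
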